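(* Let $V(i,\beta)$, for $0\le i\le N$ and $\beta\in \mathbf U^i$, be the value function of the discrete Volterra control problem, defined by $V(i,\beta)=\min_{u_{<i>}\in \mathbf U^{N-i}}J_{i,\beta}(u_{<i>})$ (all these minima being assumed to exist). Then $V$ satisfies the dynamic programming equations $$V(i,\beta)=\min_{\xi\in \mathbf U}\{V(i+1,\beta\otimes\xi)+\Phi(i,x(i;i,\beta),\xi)\}\quad\text{for all }0\le i\le N-1,\ \beta\in \mathbf U^i,$$ $$V(N,\beta)=\Phi_0(x(N;N,\beta))\quad\text{for all }\beta\in \mathbf U^N .$$
   Context: Let $N\ge 1$ be an integer, $\mathbf U\subseteq\mathbb R^m$ a compact set of control values, $x_0(i)\in\mathbb R^n$ for $0\le i\le N$, $\varphi(i,j,x,u)\in\mathbb R^n$ for $0\le j<i\le N$, $x\in\mathbb R^n$, $u\in \mathbf U$, and let $\Phi(i,x,u)\in\mathbb R$ ($0\le i\le N-1$) and $\Phi_0(x)\in\mathbb R$ be given functions. An admissible control is a sequence $u=(u(0),\dots,u(N-1))\in \mathbf U^N$. The controlled discrete Volterra equation is $$x(k)=x_0(k)+\sum_{j=0}^{k-1}\varphi(k,j,x(j),u(j)),\qquad 0\le k\le N,$$ (so $x(0)=x_0(0)$). For $\beta=(\beta(0),\dots,\beta(i-1))\in \mathbf U^i$, $x(k;i,\beta)$, $0\le k\le i$, denotes the solution of this equation for $0\le k\le i$ with $u(j)=\beta(j)$, $0\le j\le i-1$. For $i=0$, $\beta$ is the empty sequence $\emptyset$. The concatenation of $\beta=(\beta(j):0\le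 j\le i-1)$ and $\gamma=(\gamma(j): i\le j\le N-1)$ is the sequence $\beta\otimes\gamma$ equal to $\beta(j)$ for $j\le i-1$ and to $\gamma(j)$ for $j\ge i$. For $\xi\in \mathbf U$, $\beta\otimes\xi=(\beta(0),\dots,\beta(i-1),\xi)\in \mathbf U^{i+1}$. Write $u_{<i>}=(u(j): i\le j\le N-1)\in \mathbf U^{N-i}$ (empty for $i=N$). For $\beta\in \mathbf U^i$ the parametrized cost is $$J_{i,\beta}(u_{<i>})=\sum_{j=i}^{N-1}\Phi(j,x(j),u(j))+\Phi_0(x(N)),$$ where $x(\cdot)$ is the solution of the discrete Volterra equation for the control $\beta\otimes u_{<i>}$. *)

theory Defs
  imports "HOL-Analysis.Analysis" "HOL-Library.NList"
begin

text \<open>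
  The set of control sequences of length \<open>k\<close> is \<^term>\<open>nlists k U\<close>, and concatenation of control
  sequences is list append. A tail \<open>(u(j) : i \<le> j \<le> N-1)\<close> is represented by the list
  \<open>[u(i), \<dots>, u(N-1)]\<close> of length \<open>N - i\<close>, so that \<open>u(j)\<close> for \<open>j \<ge> i\<close> is entry \<open>j - i\<close> of the tail
  and entry \<open>j\<close> of the concatenation.
\<close>

text \<open>
  \<open>x\<close> solves the controlled discrete Volterra equation on \<open>0 \<le> k \<le> K\<close>. Only the entries
  \<open>u ! j\<close> with \<open>j < K\<close> are used.
\<close>

definition volterra_solution ::
  "(nat \<Rightarrow> real ^ 'n) \<Rightarrow> (nat \<Rightarrow> nat \<Rightarrow> real ^ 'n \<Rightarrow> real ^ 'm \<Rightarrow> real ^ 'n)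
    \<Rightarrow> nat \<Rightarrow> (real ^ 'm) list \<Rightarrow> (nat \<Rightarrow> real ^ 'n) \<Rightarrow> bool" where
  "volterra_solution x0 \<phi> K u x \<longleftrightarrow>
     (\<forall>k\<le>K. x k = x0 k + (\<Sum>j<k. \<phi> k j (x j) (u ! j)))"

text \<open>
  The solution \<open>x(k; i, \<beta>)\<close> with \<open>i = length \<beta>\<close>; it is meaningful for \<open>k \<le> length \<beta>\<close>.
\<close>

function volterra_state ::
  "(nat \<Rightarrow> real ^ 'n) \<Rightarrow> (nat \<Rightarrow> nat \<Rightarrow> real ^ 'n \<Rightarrow> real ^ 'm \<Rightarrow> real ^ 'n)
    \<Rightarrow> (real ^ 'm) list \<Rightarrow> nat \<Rightarrow> real ^ 'n" where
  "volterra_state x0 \<phi> u k =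
     x0 k + (\<Sum>j<k. \<phi> k j (volterra_state x0 \<phi> u j) (u ! j))"
  by pat_completeness auto
termination
  by (relation "Wellfounded.measure (\<lambda>(_, _, _, k). k)") auto

declare volterra_state.simps [simp del]

lemma volterra_solution_iff:
  "volterra_solution x0 \<phi> K u x \<longleftrightarrow> (\<forall>k\<le>K. x k = volterra_state x0 \<phi> u k)"
proof
  assume sol: "volterra_solution x0 \<phi> K u x"
  have "k \<le> K \<longrightarrow> x k = volterra_state x0 \<phi> u k" for k
  proof (induction k rule: less_induct)
    case (less k)
    show ?case
    proof
      assume k: "k \<le> K"
      have "x k = x0 k + (\<Sum>j<k. \<phi> k j (x j) (u ! j))"
        using sol k by (simp add: volterra_solution_def)
      also have "(\<Sum>j<k. \<phi> k j (x j) (u ! j))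
          = (\<Sum>j<k. \<phi> k j (volterra_state x0 \<phi> u j) (u ! j))"
        by (rule sum.cong) (use less k in auto)
      finally show "x k = volterra_state x0 \<phi> u k"
        by (simp add: volterra_state.simps[of _ _ _ k])
    qed
  qed
  then show "\<forall>k\<le>K. x k = volterra_state x0 \<phi> u k" by blast
next
  assume eq: "\<forall>k\<le>K. x k = volterra_state x0 \<phi> u k"
  show "volterra_solution x0 \<phi> K u x"
    unfolding volterra_solution_def
  proof (intro allI impI)
    fix k assume k: "k \<le> K"
    have "x k = x0 k + (\<Sum>j<k. \<phi> k j (volterra_state x0 \<phi> u j) (u ! j))"
      using eq k volterra_state.simps[of x0 \<phi> u k] by simp
    also have "(\<Sum>j<k. \<phi> k j (volterra_state x0 \<phi> u j) (u ! j))
        = (\<Sum>j<k. \<phi> k j (x j) (u ! j))"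
      by (rule sum.cong) (use eq k in auto)
    finally show "x k = x0 k + (\<Sum>j<k. \<phi> k j (x j) (u ! j))" .
  qed
qed

text \<open>The parametrized cost \<open>J\<^bsub>i,\<beta>\<^esub>(\<gamma>)\<close>, for \<open>\<beta>\<close> of length \<open>i\<close> and a tail \<open>\<gamma>\<close> of length \<open>N - i\<close>.\<close>

definition cost ::
  "nat \<Rightarrow> (nat \<Rightarrow> real ^ 'n) \<Rightarrow> (nat \<Rightarrow> nat \<Rightarrow> real ^ 'n \<Rightarrow> real ^ 'm \<Rightarrow> real ^ 'n)
    \<Rightarrow> (nat \<Rightarrow> real ^ 'n \<Rightarrow> real ^ 'm \<Rightarrow> real) \<Rightarrow> (real ^ 'n \<Rightarrow> real)
    \<Rightarrow> nat \<Rightarrow> (real ^ 'm) list \<Rightarrow> (real ^ 'm) list \<Rightarrow> real" where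
  "cost N x0 \<phi> \<Phi> \<Phi>0 i \<beta> \<gamma> =
     (let u = \<beta> @ \<gamma>; x = volterra_state x0 \<phi> u
      in (\<Sum>j = i..<N. \<Phi> j (x j) (u ! j)) + \<Phi>0 (x N))"

definition attains_min :: "('a \<Rightarrow> real) \<Rightarrow> 'a set \<Rightarrow> bool" where
  "attains_min f S \<longleftrightarrow> (\<exists>x\<in>S. \<forall>y\<in>S. f x \<le> f y)"

text \<open>
  The minimum of \<open>f\<close> over \<open>S\<close>; unspecified unless \<^term>\<open>attains_min f S\<close> holds. The library's
  \<^term>\<open>Min\<close> is not usable here because it is restricted to finite sets.
\<close>

definition min_over :: "('a \<Rightarrow> real) \<Rightarrow> 'a set \<Rightarrow> real" where
  "min_over f S = (LEAST c. c \<in> f ` S)"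

lemma min_over_eqI:
  assumes "x \<in> S" "\<And>y. y \<in> S \<Longrightarrow> f x \<le> f y"
  shows "min_over f S = f x"
  unfolding min_over_def by (rule Least_equality) (use assms in auto)

definition value_function ::
  "nat \<Rightarrow> (real ^ 'm) set \<Rightarrow> (nat \<Rightarrow> real ^ 'n)
    \<Rightarrow> (nat \<Rightarrow> nat \<Rightarrow> real ^ 'n \<Rightarrow> real ^ 'm \<Rightarrow> real ^ 'n)
    \<Rightarrow> (nat \<Rightarrow> real ^ 'n \<Rightarrow> real ^ 'm \<Rightarrow> real) \<Rightarrow> (real ^ 'n \<Rightarrow> real)
    \<Rightarrow> nat \<Rightarrow> (real ^ 'm) list \<Rightarrow> real" where
  "value_function N U x0 \<phi> \<Phi> \<Phi>0 i \<beta> =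
     min_over (cost N x0 \<phi> \<Phi> \<Phi>0 i \<beta>) (nlists (N - i) U)"

end

theory Submission
  imports Defs
begin

text \<open>A nonempty tail is a first control \<xi> followed by a shorter tail \<gamma>. The
  Volterra equation is causal (\<open>volterra_state_append\<close>), so the state at time
  \<open>i\<close> is already fixed by the history \<beta>. Hence the cost of
  \<open>\<xi> # \<gamma>\<close> after \<beta> is the cost of \<gamma> after
  \<open>\<beta> @ [\<xi>]\<close> plus a running cost free of \<gamma> (\<open>cost_Cons\<close>).
  Minimizing over \<gamma> for fixed \<xi> and then over \<xi> therefore gives the joint minimum
  (\<open>min_over_nlists_Suc\<close>). The equation has memory, which is why the value function
  takes the whole control history as argument rather than the current state.\<close>

lemma min_over_attained:
  assumes "attains_min f S"
  obtains x where "x \<in> S" "min_over f S = f x"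
proof -
  obtain x where x: "x \<in> S" "\<And>y. y \<in> S \<Longrightarrow> f x \<le> f y"
    using assms unfolding attains_min_def by blast
  then show thesis
    using that[of x] min_over_eqI[of x S f] by blast
qed

lemma min_over_le:
  assumes "attains_min f S" "y \<in> S"
  shows "min_over f S \<le> f y"
proof -
  obtain x where x: "x \<in> S" "\<And>y. y \<in> S \<Longrightarrow> f x \<le> f y"
    using assms(1) unfolding attains_min_def by blast
  then show ?thesis
    using min_over_eqI[of x S f] assms(2) by simp
qed

text \<open>The iterated minimum principle, free of any dynamics: \<open>c \<xi>\<close> is constant
  in the tail, so it passes through the inner minimum \<open>W \<xi>\<close>. Attainment of the
  outer minimum is derived, not assumed: the head of a joint minimizer attains it.\<close>

lemma min_over_nlists_Suc:
  fixes f :: "'a list \<Rightarrow> real"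
  assumes f: "attains_min f (nlists (Suc n) U)"
    and g: "\<And>\<xi>. \<xi> \<in> U \<Longrightarrow> attains_min (g \<xi>) (nlists n U)"
    and split: "\<And>\<xi> \<gamma>. \<xi> \<in> U \<Longrightarrow> \<gamma> \<in> nlists n U \<Longrightarrow> f (\<xi> # \<gamma>) = g \<xi> \<gamma> + c \<xi>"
    and W: "\<And>\<xi>. \<xi> \<in> U \<Longrightarrow> W \<xi> = min_over (g \<xi>) (nlists n U)"
  shows "attains_min (\<lambda>\<xi>. W \<xi> + c \<xi>) U"
    and "min_over f (nlists (Suc n) U) = min_over (\<lambda>\<xi>. W \<xi> + c \<xi>) U"
proof -
  let ?m = "min_over f (nlists (Suc n) U)"
  have lower: "?m \<le> W \<xi> + c \<xi>" if \<xi>: "\<xi> \<in> U" for \<xi>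
  proof -
    \<comment> \<open>An optimal tail for this \<xi> makes \<open>\<xi> # \<gamma>\<close> a
      competitor in the joint problem.\<close>
    obtain \<gamma> where \<gamma>: "\<gamma> \<in> nlists n U" "W \<xi> = g \<xi> \<gamma>"
      by (rule min_over_attained[OF g[OF \<xi>], folded W[OF \<xi>]])
    then have "?m \<le> f (\<xi> # \<gamma>)"
      using min_over_le[OF f, of "\<xi> # \<gamma>"] \<xi> by simp
    then show ?thesis
      using split[OF \<xi>] \<gamma> by simp
  qed
  \<comment> \<open>The head of a joint minimizer gives the reverse inequality, since its tail
    competes in the inner problem. That head is the witness for both conclusions.\<close>
  obtain \<beta> where \<beta>: "\<beta> \<in> nlists (Suc n) U" "?m = f \<beta>"
    by (rule min_over_attained[OF f])
  then obtain \<xi> \<gamma> where \<xi>: "\<beta> = \<xi> # \<gamma>" "\<xi> \<in> U" "\<gamma> \<in> nlists n U"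
    by (auto simp: in_nlists_Suc_iff)
  then have "W \<xi> + c \<xi> \<le> ?m"
    using min_over_le[OF g] W split \<beta> by simp
  with lower[OF \<open>\<xi> \<in> U\<close>] have eq: "?m = W \<xi> + c \<xi>"
    by simp
  then show "attains_min (\<lambda>\<xi>. W \<xi> + c \<xi>) U"
    unfolding attains_min_def using lower \<open>\<xi> \<in> U\<close> by auto
  show "?m = min_over (\<lambda>\<xi>. W \<xi> + c \<xi>) U"
    using min_over_eqI[of \<xi> U "\<lambda>\<xi>. W \<xi> + c \<xi>"] lower eq \<open>\<xi> \<in> U\<close> by simp
qed

text \<open>Causality: the state at \<open>k\<close> reads only controls with index
  \<open>j < k\<close>, all of which lie in \<beta>. The boundary case
  \<open>k = length \<beta>\<close> is the one used for the running cost.\<close>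

lemma volterra_state_append:
  "k \<le> length \<beta> \<Longrightarrow> volterra_state x0 \<phi> (\<beta> @ \<gamma>) k = volterra_state x0 \<phi> \<beta> k"
proof (induction k rule: less_induct)
  case (less k)
  have "volterra_state x0 \<phi> (\<beta> @ \<gamma>) k
      = x0 k + (\<Sum>j<k. \<phi> k j (volterra_state x0 \<phi> (\<beta> @ \<gamma>) j) ((\<beta> @ \<gamma>) ! j))"
    by (rule volterra_state.simps)
  also have "\<dots> = x0 k + (\<Sum>j<k. \<phi> k j (volterra_state x0 \<phi> \<beta> j) (\<beta> ! j))"
    using less by (intro arg_cong2[where f = "(+)"] sum.cong) (auto simp: nth_append)
  also have "\<dots> = volterra_state x0 \<phi> \<beta> k"
    by (rule volterra_state.simps[symmetric])
  finally show ?case .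
qed

text \<open>Both costs follow the same trajectory, as the concatenated control is the same list;
  they differ by the summand at \<open>j = i\<close>, where the control is \<xi> and, by causality,
  the state depends on \<beta> alone.\<close>

lemma cost_Cons:
  assumes "length \<beta> = i" "i < N"
  shows "cost N x0 \<phi> \<Phi> \<Phi>0 i \<beta> (\<xi> # \<gamma>)
    = cost N x0 \<phi> \<Phi> \<Phi>0 (Suc i) (\<beta> @ [\<xi>]) \<gamma> + \<Phi> i (volterra_state x0 \<phi> \<beta> i) \<xi>"
  using assms
  by (simp add: cost_def Let_def sum.atLeast_Suc_lessThan volterra_state_append
      nth_append)

theorem theorem2p1:
  fixes N :: nat
    and U :: "(real ^ 'm) set"
    and x0 :: "nat \<Rightarrow> real ^ 'n"
    and \<phi> :: "nat \<Rightarrow> nat \<Rightarrow> real ^ 'n \<Rightarrow> real ^ 'm \<Rightarrow> real ^ 'n"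
    and \<Phi> :: "nat \<Rightarrow> real ^ 'n \<Rightarrow> real ^ 'm \<Rightarrow> real"
    and \<Phi>0 :: "real ^ 'n \<Rightarrow> real"
    and V :: "nat \<Rightarrow> (real ^ 'm) list \<Rightarrow> real"
  assumes "N \<ge> 1"
    and "compact U"
    and "\<And>i \<beta>. i \<le> N \<Longrightarrow> \<beta> \<in> nlists i U \<Longrightarrow>
           attains_min (cost N x0 \<phi> \<Phi> \<Phi>0 i \<beta>) (nlists (N - i) U)"
    and "\<And>i \<beta>. i \<le> N \<Longrightarrow> \<beta> \<in> nlists i U \<Longrightarrow>
           V i \<beta> = value_function N U x0 \<phi> \<Phi> \<Phi>0 i \<beta>"
  shows "(\<forall>i<N. \<forall>\<beta>\<in>nlists i U.
            attains_min (\<lambda>\<xi>. V (i + 1) (\<beta> @ [\<xi>]) + \<Phi> i (volterra_state x0 \<phi> \<beta> i) \<xi>) U \<and>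
            V i \<beta> = min_over (\<lambda>\<xi>. V (i + 1) (\<beta> @ [\<xi>]) + \<Phi> i (volterra_state x0 \<phi> \<beta> i) \<xi>) U)
         \<and> (\<forall>\<beta>\<in>nlists N U. V N \<beta> = \<Phi>0 (volterra_state x0 \<phi> \<beta> N))"
proof (intro conjI allI impI ballI)
  fix i \<beta>
  assume i: "i < N" and \<beta>: "\<beta> \<in> nlists i U"
  let ?c = "\<lambda>\<xi>. \<Phi> i (volterra_state x0 \<phi> \<beta> i) \<xi>"
  let ?g = "\<lambda>\<xi>. cost N x0 \<phi> \<Phi> \<Phi>0 (i + 1) (\<beta> @ [\<xi>])"
  have snoc: "\<beta> @ [\<xi>] \<in> nlists (i + 1) U" if "\<xi> \<in> U" for \<xi>
    using nlists_appendI[OF \<beta>, of "[\<xi>]" 1] that by simp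
  \<comment> \<open>Exposes the tail length as a successor, so that tails can be split at their
    head.\<close>
  have N: "N - i = Suc (N - (i + 1))"
    using i by simp
  have f: "attains_min (cost N x0 \<phi> \<Phi> \<Phi>0 i \<beta>) (nlists (Suc (N - (i + 1))) U)"
    using assms(3)[of i \<beta>] i \<beta> N by simp
  have g: "attains_min (?g \<xi>) (nlists (N - (i + 1)) U)" if "\<xi> \<in> U" for \<xi>
    using assms(3) i snoc[OF that] by simp
  have split: "cost N x0 \<phi> \<Phi> \<Phi>0 i \<beta> (\<xi> # \<gamma>) = ?g \<xi> \<gamma> + ?c \<xi>" for \<xi> \<gamma>
    using cost_Cons[OF nlistsE_length[OF \<beta>] i] by simp
  have W: "V (i + 1) (\<beta> @ [\<xi>]) = min_over (?g \<xi>) (nlists (N - (i + 1)) U)"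
    if "\<xi> \<in> U" for \<xi>
    using assms(4) i snoc[OF that] by (simp add: value_function_def)
  note dp = min_over_nlists_Suc[of _ _ _ ?g ?c "\<lambda>\<xi>. V (i + 1) (\<beta> @ [\<xi>])", OF f g split W]
  show "attains_min (\<lambda>\<xi>. V (i + 1) (\<beta> @ [\<xi>]) + ?c \<xi>) U"
    by (rule dp(1))
  have "V i \<beta> = min_over (cost N x0 \<phi> \<Phi> \<Phi>0 i \<beta>) (nlists (Suc (N - (i + 1))) U)"
    using assms(4)[of i \<beta>] i \<beta> N by (simp add: value_function_def)
  also have "\<dots> = min_over (\<lambda>\<xi>. V (i + 1) (\<beta> @ [\<xi>]) + ?c \<xi>) U"
    by (rule dp(2))
  finally show "V i \<beta> = min_over (\<lambda>\<xi>. V (i + 1) (\<beta> @ [\<xi>]) + ?c \<xi>) U" .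
next
  fix \<beta>
  assume \<beta>: "\<beta> \<in> nlists N U"
  \<comment> \<open>At the final time the only tail is the empty list and the running sum is empty,
    which leaves the terminal cost.\<close>
  have "min_over (cost N x0 \<phi> \<Phi> \<Phi>0 N \<beta>) {[]} = cost N x0 \<phi> \<Phi> \<Phi>0 N \<beta> []"
    by (rule min_over_eqI) auto
  then show "V N \<beta> = \<Phi>0 (volterra_state x0 \<phi> \<beta> N)"
    using assms(4)[of N \<beta>] \<beta> by (simp add: value_function_def cost_def)
qed

end
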